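(* Let $V$ be a real Hilbert space with norm $\|\cdot\|_V$, and let $\{V^h\}_h$ be a family of finite-dimensional subspaces $V^h\subset V$ indexed by a parameter $h>0$. Let $a:V\times V\to\mathbb{R}$ be a bilinear, continuous and coercive form, with $a(u,v)\le C_1\|u\|_V\|v\|_V$ for all $u,v\in V$. Let $F:V\to\mathbb{R}$ be a linear and continuous functional, and let $G:V\to\mathbb{R}$ be an affine and continuous functional. Let $u\in V$ be the solution of $$a(u,v)=F(v)\quad\text{for all } v\in V,$$ and, for each $h$, let $u^h\in V^h$ be the solution of $$a(u^h,v^h)=F(v^h)\quad\text{for all } v^h\in V^h.$$ Let $w\in V$ be the unique element of $V$ such that $$a(v,w)=G(v)-G(0)\quad\text{for all } v\in V.$$ Let $k$ be a real number, and assume that there exist positive real numbers $C_2$ and $C_3$, independent of $h$, such that for every $h$ $$\|u-u^h\|_V\le C_2h^k\qquad\text{and}\qquad \inf_{w^h\in V^h}\|w-w^h\|_V\le C_3h^k.$$ Then there exists a constant $C$ independent of $h$ such that for every $h$ $$\left|G(u)-G(u^h)\right|\le C\,h^{2k}.$$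
   Context: Coercive means that there is a constant $c>0$ with $a(v,v)\ge c\|v\|_V^2$ for all $v\in V$. A functional $G:V\to\mathbb{R}$ is affine if $v\mapsto G(v)-G(0)$ is linear. "Independent of $h$" means that the same constant works for every value of $h$ in the index set of the family $\{V^h\}_h$. *)

theory Defs
  imports "HOL-Analysis.Analysis"
begin

definition coercive_form :: "('a::real_inner \<Rightarrow> 'a \<Rightarrow> real) \<Rightarrow> bool"
  where "coercive_form a \<longleftrightarrow> (\<exists>c>0. \<forall>v. a v v \<ge> c * (norm v)\<^sup>2)"

definition affine_functional :: "('a::real_vector \<Rightarrow> real) \<Rightarrow> bool"
  where "affine_functional G \<longleftrightarrow> linear (\<lambda>v. G v - G 0)"

definition finite_dim_subspace :: "'a::real_vector set \<Rightarrow> bool"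
  where "finite_dim_subspace S \<longleftrightarrow> subspace S \<and> (\<exists>B. finite B \<and> S = span B)"

end

theory Submission
  imports Defs
begin

text \<open>Aubin--Nitsche duality: the quantity error is \<open>a (u - u\<^sub>h) w\<close>, and Galerkin orthogonality allows
  replacing \<open>w\<close> by \<open>w - w\<^sub>h\<close> for any discrete \<open>w\<^sub>h\<close>, so the primal and the dual errors multiply.\<close>

text \<open>The bound at \<open>- x\<close> controls \<open>- a x y\<close>, and \<open>- x\<close>
  has the same norm as \<open>x\<close>.\<close>

lemma bilinear_abs_bound:
  fixes a :: "'v::real_normed_vector \<Rightarrow> 'w::real_normed_vector \<Rightarrow> real"
  assumes "bilinear a" and bound: "\<And>x y. a x y \<le> C * norm x * norm y"
  shows "\<bar>a x y\<bar> \<le> C * norm x * norm y"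
  using bound[of x y] bound[of "- x" y] bilinear_lneg[OF \<open>bilinear a\<close>, of x y] by simp

lemma Galerkin_orthogonality_bound:
  fixes a :: "'v::real_normed_vector \<Rightarrow> 'w::real_normed_vector \<Rightarrow> real"
  assumes "bilinear a" and "\<And>x y. a x y \<le> C * norm x * norm y" and "a e z = 0"
  shows "\<bar>a e w\<bar> \<le> C * norm e * norm (w - z)"
  using bilinear_abs_bound[OF assms(1,2), of e "w - z"] assms(3)
  by (simp add: bilinear_rsub[OF assms(1)])

theorem mainTheorem1:
  fixes H :: "real set"
    and Vh :: "real \<Rightarrow> 'v::{real_inner, complete_space} set"
    and a :: "'v \<Rightarrow> 'v \<Rightarrow> real"
    and F G :: "'v \<Rightarrow> real"
    and u w :: 'v
    and uh :: "real \<Rightarrow> 'v"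
    and k C1 C2 C3 :: real
  assumes "\<And>h. h \<in> H \<Longrightarrow> h > 0"
    and "\<And>h. h \<in> H \<Longrightarrow> finite_dim_subspace (Vh h)"
    and "bilinear a"
    and "continuous_on UNIV (\<lambda>(x, y). a x y)"
    and "\<And>x y. a x y \<le> C1 * norm x * norm y"
    and "coercive_form a"
    and "linear F" and "continuous_on UNIV F"
    and "affine_functional G" and "continuous_on UNIV G"
    and "\<And>v. a u v = F v"
    and "\<And>h. h \<in> H \<Longrightarrow> uh h \<in> Vh h"
    and "\<And>h vh. h \<in> H \<Longrightarrow> vh \<in> Vh h \<Longrightarrow> a (uh h) vh = F vh"
    and "\<And>v. a v w = G v - G 0"
    and "C2 > 0" and "C3 > 0"
    and "\<And>h. h \<in> H \<Longrightarrow> norm (u - uh h) \<le> C2 * h powr k"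
    and "\<And>h. h \<in> H \<Longrightarrow> (INF wh\<in>Vh h. norm (w - wh)) \<le> C3 * h powr k"
  shows "\<exists>C. \<forall>h\<in>H. \<bar>G u - G (uh h)\<bar> \<le> C * h powr (2 * k)"
proof (intro exI ballI)
  fix h assume h: "h \<in> H"
  let ?e = "u - uh h"
  have pos: "h powr k > 0" using assms(1)[OF h] by simp
  \<comment> \<open>The infimum is not assumed to be attained. Doubling the positive bound makes the
    inequality strict, so some actual \<open>wh\<close> satisfies it.\<close>
  have "(INF wh\<in>Vh h. norm (w - wh)) < 2 * C3 * h powr k"
    using assms(18)[OF h] mult_pos_pos[OF \<open>C3 > 0\<close> pos] by linarith
  moreover have "Vh h \<noteq> {}" using assms(12)[OF h] by blast
  moreover have "bdd_below ((\<lambda>wh. norm (w - wh)) ` Vh h)"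
    by (rule bdd_belowI2[of _ 0]) simp
  ultimately obtain wh where wh: "wh \<in> Vh h" "norm (w - wh) < 2 * C3 * h powr k"
    by (auto simp: cINF_less_iff)
  \<comment> \<open>Both the continuous and the discrete problem admit \<open>wh\<close> as a test
    function.\<close>
  have "a ?e wh = 0"
    using assms(11)[of wh] assms(13)[OF h wh(1)] by (simp add: bilinear_lsub[OF assms(3)])
  then have "\<bar>a ?e w\<bar> \<le> C1 * norm ?e * norm (w - wh)"
    by (rule Galerkin_orthogonality_bound[OF assms(3,5)])
  \<comment> \<open>The sign of \<open>C1\<close> is not given; \<open>\<bar>C1\<bar>\<close> keeps
    every factor nonnegative for monotonicity.\<close>
  also have "\<dots> \<le> \<bar>C1\<bar> * (C2 * h powr k) * (2 * C3 * h powr k)"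
    using assms(17)[OF h] wh(2) pos \<open>C2 > 0\<close> by (intro mult_mono) auto
  also have "\<dots> = (2 * \<bar>C1\<bar> * C2 * C3) * h powr (2 * k)"
    unfolding mult_2[of k] powr_add by (simp only: mult_ac)
  \<comment> \<open>By duality \<open>w\<close> represents the linear part of \<open>G\<close>, so
    \<open>G 0\<close> cancels in the difference.\<close>
  also have "a ?e w = G u - G (uh h)"
    using assms(14)[of u] assms(14)[of "uh h"] by (simp add: bilinear_lsub[OF assms(3)])
  \<comment> \<open>This fixes the witness left open by \<open>exI\<close>. It was introduced before
    \<open>h\<close>, so it cannot depend on \<open>h\<close>.\<close>
  finally show "\<bar>G u - G (uh h)\<bar> \<le> (2 * \<bar>C1\<bar> * C2 * C3) * h powr (2 * k)" .
qed

end
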